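(* Let $\xi=(\xi_1,\xi_2)=(\mu,\mu^2+\sigma^2)$ be the dual coordinate system associated with the Gaussian statistical manifold with natural coordinates $\theta=(\theta_1,\theta_2)=(\mu,\sigma)\in\mathbb{R}\times(0,\infty)$. Let $(g_{ij}(\theta))_{1\le i,j\le 2}=\begin{pmatrix}\frac{1}{\sigma^2}&0\\0&\frac{2}{\sigma^2}\end{pmatrix}$ be the Riemannian (Fisher) metric expressed in the natural coordinate system $\theta$. Let $(\overline{B}_\alpha^{\,i})$ denote the inverse of the Jacobian matrix of the coordinate transformation from $\theta$ to $\xi$, given explicitly by $$(\overline{B}_\alpha^{\,i})=\left(\begin{matrix}\frac{\partial\theta_1}{\partial\xi_1}&\frac{\partial\theta_1}{\partial\xi_2}\\ \frac{\partial\theta_2}{\partial\xi_1}&\frac{\partial\theta_2}{\partial\xi_2}\end{matrix}\right)=\begin{pmatrix}1&0\\-\frac{\mu}{\sigma}&\frac{1}{2\sigma}\end{pmatrix},\qquad \overline{B}_\alpha^{\,i}=\frac{\partial\theta_i}{\partial\xi_\alpha}.$$ Then the components of the Riemannian metric $g_{\alpha\beta}(\xi)$ in the $\xi$-coordinate system are given, for $\alpha,\beta\in\{1,2\}$, by $$g_{\alpha\beta}(\xi)=\frac{1}{\sigma^{2}}\,\overline{B}_\alpha^{\,1}\,\overline{B}_\beta^{\,1}+\frac{2}{\sigma^{2}}\,\overline{B}_\alpha^{\,2}\,\overline{B}_\beta^{\,2}.$$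
   Context: The Gaussian statistical manifold is $S=\{p_\theta(x)=\frac{1}{\sqrt{2\pi}\,\sigma}e^{-(x-\mu)^2/(2\sigma^2)} : \theta=(\mu,\sigma)\in\mathbb{R}\times(0,\infty)\}$, $x\in\mathbb{R}$, with $l(x,\theta)=\log p_\theta(x)$. Its Riemannian metric is the Fisher information metric $g_{ij}(\theta)=\langle\partial_i,\partial_j\rangle=\mathbb{E}[\partial_i l\,\partial_j l]$, where $\partial_1=\frac{\partial}{\partial\mu}$, $\partial_2=\frac{\partial}{\partial\sigma}$ and the expectation is with respect to $p_\theta$. The components in the $\xi$-coordinate system are $g_{\alpha\beta}(\xi)=\langle\partial_{\xi_\alpha},\partial_{\xi_\beta}\rangle$, with $\partial_{\xi_\alpha}=\frac{\partial}{\partial\xi_\alpha}=\sum_{i=1}^2\overline{B}_\alpha^{\,i}\partial_i$. *)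

theory Defs
  imports "HOL-Probability.Probability"
begin

text \<open>
  Points of the statistical manifold are probability densities on the real line.  A coordinate
  system is given by its parametrization, the map from coordinates to densities.
\<close>

definition natural_domain :: "(real^2) set" where
  "natural_domain = {\<theta>. \<theta> $ 2 > 0}"

text \<open>The second coordinate is the standard deviation \<open>\<sigma>\<close>, not the variance.\<close>

definition gauss :: "real^2 \<Rightarrow> (real \<Rightarrow> real)" where
  "gauss \<theta> = normal_density (\<theta> $ 1) (\<theta> $ 2)"

definition dual_coord :: "real^2 \<Rightarrow> real^2" where
  "dual_coord \<theta> = vector [\<theta> $ 1, (\<theta> $ 1)\<^sup>2 + (\<theta> $ 2)\<^sup>2]"

text \<open>Unspecified outside the open set \<open>dual_coord ` natural_domain\<close>.\<close>

definition natural_of_dual :: "real^2 \<Rightarrow> real^2" where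
  "natural_of_dual = the_inv_into natural_domain dual_coord"

definition gauss_dual :: "real^2 \<Rightarrow> (real \<Rightarrow> real)" where
  "gauss_dual \<xi> = gauss (natural_of_dual \<xi>)"

definition partial_deriv :: "2 \<Rightarrow> (real^2 \<Rightarrow> real) \<Rightarrow> real^2 \<Rightarrow> real" where
  "partial_deriv i f c = deriv (\<lambda>t. f (c + t *\<^sub>R axis i 1)) 0"

text \<open>
  The coordinate tangent vector \<open>\<partial>/\<partial>c\<^sub>i\<close> of a parametrization \<open>P\<close> at the point \<open>P c\<close>, as a
  derivation acting on real functions \<open>F\<close> of densities.
\<close>

definition coord_vector ::
  "(real^2 \<Rightarrow> (real \<Rightarrow> real)) \<Rightarrow> real^2 \<Rightarrow> 2 \<Rightarrow> ((real \<Rightarrow> real) \<Rightarrow> real) \<Rightarrow> real" where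
  "coord_vector P c i F = partial_deriv i (\<lambda>c'. F (P c')) c"

definition log_likelihood :: "real \<Rightarrow> (real \<Rightarrow> real) \<Rightarrow> real" where
  "log_likelihood x p = ln (p x)"

text \<open>The Fisher metric on tangent vectors: \<open>\<langle>X, Y\<rangle> = E[(X l) (Y l)]\<close>, expectation with respect to \<open>p\<close>.\<close>

definition fisher_inner ::
  "(real \<Rightarrow> real) \<Rightarrow> (((real \<Rightarrow> real) \<Rightarrow> real) \<Rightarrow> real) \<Rightarrow> (((real \<Rightarrow> real) \<Rightarrow> real) \<Rightarrow> real) \<Rightarrow> real" where
  "fisher_inner p X Y =
     (LINT x|density lborel (\<lambda>x. ennreal (p x)). X (log_likelihood x) * Y (log_likelihood x))"

definition fisher_metric :: "(real^2 \<Rightarrow> (real \<Rightarrow> real)) \<Rightarrow> real^2 \<Rightarrow> real^2^2" where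
  "fisher_metric P c = (\<chi> i j. fisher_inner (P c) (coord_vector P c i) (coord_vector P c j))"

text \<open>Row index \<open>i\<close>, column index \<open>\<alpha>\<close>: the entry \<open>Bbar \<theta> $ i $ \<alpha>\<close> is \<open>\<partial>\<theta>\<^sub>i/\<partial>\<xi>\<^sub>\<alpha>\<close>.\<close>

definition Bbar :: "real^2 \<Rightarrow> real^2^2" where
  "Bbar \<theta> = matrix_inv (jacobian dual_coord (at \<theta>))"

end

theory Submission
  imports Defs
begin

text \<open>
  Along any differentiable curve of parameters the derivative of the log-likelihood is a linear
  combination of the two scores, so the Fisher metric of every reparametrization of the Gaussian
  family is the pull-back of the second moments of the scores. These moments reduce to the central
  moments of order at most four. The dual chart is inverted explicitly by
  \<open>(\<xi>\<^sub>1, sqrt (\<xi>\<^sub>2 - \<xi>\<^sub>1\<^sup>2))\<close>, whose derivatives are the entries of the inverse Jacobian.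
\<close>

text \<open>The gradient of the log-density in the mean and the standard deviation, in closed form;
  the term \<open>- 1 / \<theta> $ 2\<close> comes from the normalizing factor.\<close>

definition score :: "real^2 \<Rightarrow> real \<Rightarrow> real^2" where
  "score \<theta> x = vector [(x - \<theta> $ 1) / (\<theta> $ 2)\<^sup>2, (x - \<theta> $ 1)\<^sup>2 / (\<theta> $ 2) ^ 3 - 1 / \<theta> $ 2]"

lemma ln_normal_density:
  assumes "s > 0"
  shows "ln (normal_density m s x) = - ((x - m)\<^sup>2 / (2 * s\<^sup>2)) - ln s - ln (sqrt (2 * pi))"
  using assms by (simp add: normal_density_def ln_mult ln_div real_sqrt_mult)

text \<open>Chain rule for the log-density. Allowing an arbitrary curve \<open>c\<close> lets the
  coordinate lines of both charts be treated at once.\<close>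

lemma has_real_derivative_log_gauss:
  assumes pos: "c 0 $ 2 > 0"
    and d1: "((\<lambda>t. c t $ 1) has_real_derivative a) (at 0)"
    and d2: "((\<lambda>t. c t $ 2) has_real_derivative b) (at 0)"
  shows "((\<lambda>t. log_likelihood x (gauss (c t))) has_real_derivative
    a * score (c 0) x $ 1 + b * score (c 0) x $ 2) (at 0)"
proof -
  let ?f = "\<lambda>t. - ((x - c t $ 1)\<^sup>2 / (2 * (c t $ 2)\<^sup>2)) - ln (c t $ 2) - ln (sqrt (2 * pi))"
  \<comment> \<open>The closed form of the logarithm needs a positive deviation; continuity keeps it
    positive near 0, which is enough for the derivative at 0.\<close>
  have "isCont (\<lambda>t. c t $ 2) 0"
    using d2 by (rule DERIV_isCont)
  then have "eventually (\<lambda>t. c t $ 2 > 0) (nhds 0)"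
    using pos by (metis isContD tendsto_at_iff_tendsto_nhds order_tendstoD(1))
  then have ev: "eventually (\<lambda>t. log_likelihood x (gauss (c t)) = ?f t) (nhds 0)"
    by eventually_elim (simp add: log_likelihood_def gauss_def ln_normal_density)
  have "(?f has_real_derivative a * score (c 0) x $ 1 + b * score (c 0) x $ 2) (at 0)"
    using pos by (auto intro!: derivative_eq_intros d1 d2
        simp: score_def field_simps power2_eq_square power3_eq_cube power4_eq_xxxx)
  then show ?thesis
    using DERIV_cong_ev[OF refl ev refl] by blast
qed

text \<open>The integrand is a quartic polynomial in the centered variable times the density. Odd
  central moments vanish, which removes the mixed terms in \<open>u\<close> and
  \<open>v\<close>.\<close>

lemma gauss_score_moment:
  fixes u v :: "real^2"
  assumes pos: "\<theta> $ 2 > 0"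
  shows "(LINT x|density lborel (\<lambda>x. ennreal (gauss \<theta> x)).
      (u $ 1 * score \<theta> x $ 1 + u $ 2 * score \<theta> x $ 2) *
      (v $ 1 * score \<theta> x $ 1 + v $ 2 * score \<theta> x $ 2)) =
    1 / (\<theta> $ 2)\<^sup>2 * u $ 1 * v $ 1 + 2 / (\<theta> $ 2)\<^sup>2 * u $ 2 * v $ 2"
proof -
  define m s where "m = \<theta> $ 1" and "s = \<theta> $ 2"
  have s: "s > 0" using pos by (simp add: s_def)
  let ?N = "\<lambda>k x. normal_density m s x * (x - m) ^ k"
  \<comment> \<open>\<open>ck\<close> is the coefficient of \<open>(x - m) ^ k\<close> in the
    product of the two score combinations.\<close>
  define c0 c1 c2 c3 c4 where
    "c0 = u $ 2 * v $ 2 / s\<^sup>2"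
    and "c1 = - (u $ 1 * v $ 2 + u $ 2 * v $ 1) / s ^ 3"
    and "c2 = u $ 1 * v $ 1 / s ^ 4 - 2 * u $ 2 * v $ 2 / s ^ 4"
    and "c3 = (u $ 1 * v $ 2 + u $ 2 * v $ 1) / s ^ 5"
    and "c4 = u $ 2 * v $ 2 / s ^ 6"
  have m0: "has_bochner_integral lborel (?N 0) 1"
    using normal_moment_even[OF s, of m 0] by simp
  have m1: "has_bochner_integral lborel (?N 1) 0"
    using normal_moment_odd[OF s, of m 0] by simp
  have m2: "has_bochner_integral lborel (?N 2) (s\<^sup>2)"
    using normal_moment_even[OF s, of m 1] by simp
  have m3: "has_bochner_integral lborel (?N 3) 0"
    using normal_moment_odd[OF s, of m 1] by simp
  \<comment> \<open>The even moment \<open>fact (2 * k) / ((2 / s\<^sup>2) ^ k * fact k)\<close> at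
    \<open>k = 2\<close> is 24/8 times \<open>s ^ 4\<close>.\<close>
  have m4: "has_bochner_integral lborel (?N 4) (3 * s ^ 4)"
    using normal_moment_even[OF s, of m 2] by (simp add: fact_numeral power_divide)
  have sum: "has_bochner_integral lborel
      (\<lambda>x. c0 * ?N 0 x + c1 * ?N 1 x + c2 * ?N 2 x + c3 * ?N 3 x + c4 * ?N 4 x)
      (c0 * 1 + c1 * 0 + c2 * s\<^sup>2 + c3 * 0 + c4 * (3 * s ^ 4))"
    by (intro has_bochner_integral_add has_bochner_integral_mult_right m0 m1 m2 m3 m4)
  have expand: "normal_density m s x * ((u $ 1 * score \<theta> x $ 1 + u $ 2 * score \<theta> x $ 2) *
      (v $ 1 * score \<theta> x $ 1 + v $ 2 * score \<theta> x $ 2)) =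
    c0 * ?N 0 x + c1 * ?N 1 x + c2 * ?N 2 x + c3 * ?N 3 x + c4 * ?N 4 x" for x
  proof -
    \<comment> \<open>Writing \<open>r\<close> for \<open>1 / s\<close> removes all divisions and
      leaves a polynomial identity.\<close>
    define y r where "y = x - m" and "r = 1 / s"
    have sc: "score \<theta> x $ 1 = y * r\<^sup>2" "score \<theta> x $ 2 = y\<^sup>2 * r ^ 3 - r"
      by (simp_all add: score_def m_def s_def y_def r_def power_divide)
    have cs: "c0 = u $ 2 * v $ 2 * r\<^sup>2" "c1 = - (u $ 1 * v $ 2 + u $ 2 * v $ 1) * r ^ 3"
      "c2 = u $ 1 * v $ 1 * r ^ 4 - 2 * u $ 2 * v $ 2 * r ^ 4"
      "c3 = (u $ 1 * v $ 2 + u $ 2 * v $ 1) * r ^ 5" "c4 = u $ 2 * v $ 2 * r ^ 6"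
      by (simp_all add: c0_def c1_def c2_def c3_def c4_def r_def power_divide)
    show ?thesis
      unfolding sc cs y_def[symmetric] by algebra
  qed
  have [measurable]: "(\<lambda>x. score \<theta> x $ 1) \<in> borel_measurable borel"
    "(\<lambda>x. score \<theta> x $ 2) \<in> borel_measurable borel"
    by (simp_all add: score_def)
  have "(LINT x|density lborel (\<lambda>x. ennreal (gauss \<theta> x)).
      (u $ 1 * score \<theta> x $ 1 + u $ 2 * score \<theta> x $ 2) *
      (v $ 1 * score \<theta> x $ 1 + v $ 2 * score \<theta> x $ 2)) =
    (LINT x|lborel. c0 * ?N 0 x + c1 * ?N 1 x + c2 * ?N 2 x + c3 * ?N 3 x + c4 * ?N 4 x)"
    unfolding gauss_def m_def[symmetric] s_def[symmetric]
    by (subst integral_density) (simp_all add: expand)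
  also have "\<dots> = c0 * 1 + c1 * 0 + c2 * s\<^sup>2 + c3 * 0 + c4 * (3 * s ^ 4)"
    using sum by (rule has_bochner_integral_integral_eq)
  \<comment> \<open>The coefficient of \<open>u $ 2 * v $ 2 / s\<^sup>2\<close> is 1 - 2 + 3 = 2,
    from the moments of order 0, 2 and 4.\<close>
  also have "\<dots> = 1 / s\<^sup>2 * u $ 1 * v $ 1 + 2 / s\<^sup>2 * u $ 2 * v $ 2"
    using s by (simp add: c0_def c2_def c4_def field_simps)
  finally show ?thesis
    by (simp add: s_def)
qed

text \<open>Column \<alpha> of \<open>D\<close> is the velocity of the coordinate line \<alpha> in
  natural coordinates; two columns serve as \<open>u\<close> and \<open>v\<close> in
  \<open>gauss_score_moment\<close>.\<close>

lemma fisher_metric_reparametrized: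
  fixes D :: "real^2^2"
  assumes pos: "\<phi> c $ 2 > 0"
    and D: "\<And>i \<alpha>. ((\<lambda>t. \<phi> (c + t *\<^sub>R axis \<alpha> 1) $ i) has_real_derivative D $ i $ \<alpha>) (at 0)"
  shows "fisher_metric (\<lambda>c. gauss (\<phi> c)) c $ \<alpha> $ \<beta> =
    1 / (\<phi> c $ 2)\<^sup>2 * D $ 1 $ \<alpha> * D $ 1 $ \<beta> + 2 / (\<phi> c $ 2)\<^sup>2 * D $ 2 $ \<alpha> * D $ 2 $ \<beta>"
proof -
  have X: "coord_vector (\<lambda>c. gauss (\<phi> c)) c \<gamma> (log_likelihood x) =
      D $ 1 $ \<gamma> * score (\<phi> c) x $ 1 + D $ 2 $ \<gamma> * score (\<phi> c) x $ 2" for x \<gamma>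
    using has_real_derivative_log_gauss[of "\<lambda>t. \<phi> (c + t *\<^sub>R axis \<gamma> 1)", OF _ D D, of x] pos
    by (simp add: coord_vector_def partial_deriv_def DERIV_imp_deriv)
  show ?thesis
    using gauss_score_moment[OF pos, of "\<chi> i. D $ i $ \<alpha>" "\<chi> i. D $ i $ \<beta>"]
    by (simp add: fisher_metric_def fisher_inner_def X)
qed

text \<open>The assumption says that the variance is positive. Equal variances give deviations equal
  up to sign, and positivity fixes the sign.\<close>

lemma natural_of_dual_eq:
  assumes "(\<zeta> $ 1)\<^sup>2 < \<zeta> $ 2"
  shows "natural_of_dual \<zeta> = vector [\<zeta> $ 1, sqrt (\<zeta> $ 2 - (\<zeta> $ 1)\<^sup>2)]"
  unfolding natural_of_dual_def
proof (rule the_inv_into_f_eq)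
  show "inj_on dual_coord natural_domain"
    by (auto simp: inj_on_def natural_domain_def dual_coord_def vec_eq_iff forall_2 power2_eq_iff)
qed (use assms in \<open>auto simp: natural_domain_def dual_coord_def vec_eq_iff forall_2\<close>)

lemma natural_of_dual_dual_coord:
  assumes "\<theta> $ 2 > 0"
  shows "natural_of_dual (dual_coord \<theta>) = \<theta>"
  using assms by (subst natural_of_dual_eq) (auto simp: dual_coord_def vec_eq_iff forall_2)

lemma Bbar_eq:
  assumes "\<theta> $ 2 \<noteq> 0"
  shows "Bbar \<theta> = vector [vector [1, 0], vector [- (\<theta> $ 1 / \<theta> $ 2), 1 / (2 * \<theta> $ 2)]]"
    (is "_ = ?B")
proof -
  let ?J = "vector [vector [1, 0], vector [2 * \<theta> $ 1, 2 * \<theta> $ 2]] :: real^2^2"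
  have "(dual_coord has_derivative (\<lambda>h. ?J *v h)) (at \<theta>)"
    unfolding has_derivative_componentwise_within[of dual_coord]
    by (auto simp: Basis_vec_def inner_axis dual_coord_def matrix_vector_mult_def sum_2
        cart_eq_inner_axis[symmetric] exhaust_2 forall_2
        intro!: derivative_eq_intros bounded_linear.has_derivative[OF bounded_linear_vec_nth])
  then have J: "jacobian dual_coord (at \<theta>) = ?J"
    unfolding jacobian_def by (metis frechet_derivative_at matrix_of_matrix_vector_mul)
  have BJ: "?B ** ?J = mat 1" and JB: "?J ** ?B = mat 1"
    using assms by (auto simp: matrix_matrix_mult_def mat_def vec_eq_iff forall_2 sum_2)
  \<comment> \<open>\<open>matrix_inv\<close> chooses some two-sided inverse, so its value follows
    from uniqueness.\<close>
  have "matrix_inv ?J = ?B"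
    unfolding matrix_inv_def
  proof (rule some_equality)
    show "?J ** ?B = mat 1 \<and> ?B ** ?J = mat 1"
      using BJ JB by blast
  next
    fix A :: "real^2^2"
    assume A: "?J ** A = mat 1 \<and> A ** ?J = mat 1"
    have "A = A ** (?J ** ?B)"
      by (simp only: JB matrix_mul_rid)
    also have "\<dots> = ?B"
      using A by (simp only: matrix_mul_assoc matrix_mul_lid)
    finally show "A = ?B" .
  qed
  then show ?thesis
    by (simp add: Bbar_def J)
qed

text \<open>Differentiating the explicit inverse chart gives the entries found by inverting the
  Jacobian matrix.\<close>

lemma has_real_derivative_natural_of_dual:
  assumes pos: "\<theta> $ 2 > 0"
  shows "((\<lambda>t. natural_of_dual (dual_coord \<theta> + t *\<^sub>R axis \<alpha> 1) $ i) has_real_derivative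
    Bbar \<theta> $ i $ \<alpha>) (at 0)"
proof -
  let ?c = "\<lambda>t. dual_coord \<theta> + t *\<^sub>R axis \<alpha> 1 :: real^2"
  let ?n = "\<lambda>\<zeta>::real^2. vector [\<zeta> $ 1, sqrt (\<zeta> $ 2 - (\<zeta> $ 1)\<^sup>2)] :: real^2"
  \<comment> \<open>At 0 this expression is the variance, so the explicit formula remains valid for
    small \<open>t\<close>.\<close>
  have "((\<lambda>t. ?c t $ 2 - (?c t $ 1)\<^sup>2) \<longlongrightarrow> ?c 0 $ 2 - (?c 0 $ 1)\<^sup>2) (nhds 0)"
    by (intro tendsto_intros filterlim_ident)
  moreover have "?c 0 $ 2 - (?c 0 $ 1)\<^sup>2 > 0"
    using pos by (simp add: dual_coord_def)
  ultimately have "eventually (\<lambda>t. ?c t $ 2 - (?c t $ 1)\<^sup>2 > 0) (nhds 0)"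
    by (rule order_tendstoD(1))
  then have ev: "eventually (\<lambda>t. natural_of_dual (?c t) $ i = ?n (?c t) $ i) (nhds 0)"
    by eventually_elim (simp add: natural_of_dual_eq)
  have "((\<lambda>t. ?n (?c t) $ i) has_real_derivative Bbar \<theta> $ i $ \<alpha>) (at 0)"
    using pos exhaust_2[of i] exhaust_2[of \<alpha>]
    by (auto simp: Bbar_eq dual_coord_def axis_def divide_simps intro!: derivative_eq_intros)
  then show ?thesis
    using DERIV_cong_ev[OF refl ev refl] by blast
qed

theorem theorem2:
  fixes \<mu> \<sigma> :: real and \<theta> \<xi> :: "real^2" and B :: "real^2^2"
  assumes "\<sigma> > 0"
    and "\<theta> = vector [\<mu>, \<sigma>]"
    and "\<xi> = dual_coord \<theta>"
    and "B = Bbar \<theta>"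
  shows "fisher_metric gauss \<theta> = vector [vector [1 / \<sigma>\<^sup>2, 0], vector [0, 2 / \<sigma>\<^sup>2]] \<and>
    (\<forall>i \<alpha>. B $ i $ \<alpha> = partial_deriv \<alpha> (\<lambda>\<zeta>. natural_of_dual \<zeta> $ i) \<xi>) \<and>
    B = vector [vector [1, 0], vector [- (\<mu> / \<sigma>), 1 / (2 * \<sigma>)]] \<and>
    (\<forall>\<alpha> \<beta>. fisher_metric gauss_dual \<xi> $ \<alpha> $ \<beta> =
       1 / \<sigma>\<^sup>2 * B $ 1 $ \<alpha> * B $ 1 $ \<beta> + 2 / \<sigma>\<^sup>2 * B $ 2 $ \<alpha> * B $ 2 $ \<beta>)"
proof -
  have \<theta>: "\<theta> $ 1 = \<mu>" "\<theta> $ 2 = \<sigma>" and pos: "\<theta> $ 2 > 0"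
    using assms by simp_all
  \<comment> \<open>Natural coordinates are the trivial reparametrization, with identity
    Jacobian.\<close>
  have "((\<lambda>t. (\<theta> + t *\<^sub>R axis \<alpha> 1) $ i) has_real_derivative (mat 1 :: real^2^2) $ i $ \<alpha>) (at 0)"
    for i \<alpha> :: 2
    by (auto simp: mat_def axis_def intro!: derivative_eq_intros)
  from fisher_metric_reparametrized[of "\<lambda>\<theta>. \<theta>", OF pos this]
  have "fisher_metric gauss \<theta> = vector [vector [1 / \<sigma>\<^sup>2, 0], vector [0, 2 / \<sigma>\<^sup>2]]"
    by (simp add: vec_eq_iff forall_2 mat_def \<theta>)
  moreover have "B $ i $ \<alpha> = partial_deriv \<alpha> (\<lambda>\<zeta>. natural_of_dual \<zeta> $ i) \<xi>" for i \<alpha>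
    using has_real_derivative_natural_of_dual[OF pos, THEN DERIV_imp_deriv]
    by (simp add: assms(3,4) partial_deriv_def)
  moreover have "B = vector [vector [1, 0], vector [- (\<mu> / \<sigma>), 1 / (2 * \<sigma>)]]"
    using Bbar_eq[of \<theta>] pos \<theta> by (simp add: assms(4))
  moreover have "fisher_metric gauss_dual \<xi> $ \<alpha> $ \<beta> =
      1 / \<sigma>\<^sup>2 * B $ 1 $ \<alpha> * B $ 1 $ \<beta> + 2 / \<sigma>\<^sup>2 * B $ 2 $ \<alpha> * B $ 2 $ \<beta>" for \<alpha> \<beta>
    \<comment> \<open>Here the reparametrization is the inverse chart and \<open>D\<close> is
      \<open>B\<close>; the prefactors are evaluated at \<open>natural_of_dual \<xi>\<close>, which
      is \<theta>.\<close>
    using fisher_metric_reparametrized[of natural_of_dual \<xi> B \<alpha> \<beta>]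
      has_real_derivative_natural_of_dual[OF pos] pos
    by (simp add: assms(3,4) natural_of_dual_dual_coord \<theta> gauss_dual_def[abs_def])
  ultimately show ?thesis
    by blast
qed

end
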